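(* Let $N\ge2$ and let $x_1,\dots,x_s\in\mathbb{R}^N$ be the vertices of an $N$-dimensional convex polyhedron $\mathcal{K}\subset\mathbb{R}^N$, so that $$ \mathcal{K}=\left\{x\in\mathbb{R}^N:\ x=\sum_{i=1}^s\lambda_i x_i,\ \text{with } \sum_{i=1}^s\lambda_i=1,\ \lambda_i\in[0,1]\right\}. $$ For a fixed $\omega\in\mathbb{S}^{N-1}$, let $f_\omega(y)=\frac{a_\omega(y)+b_\omega(y)}{2}$ for $y\in\mathcal{S}_\omega(\mathcal{K})$. Then $$ \mathcal{R}_{\mathcal{K}}(\omega)=\max\{f_\omega(y_j):\ j=1,\dots,s\}, $$ where $y_j=\mathcal{P}_\omega(x_j)$ is the projection of $x_j$ on $\mathcal{S}_\omega(\mathcal{K})$, for every $j=1,\dots,s$.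
   Context: For $\omega\in\mathbb{S}^{N-1}$ (the unit sphere) and $\lambda\in\mathbb{R}$: $\mathcal{K}^+_{\lambda,\omega}=\{x\in\mathcal{K}: x\cdot\omega>\lambda\}$, and $\mathcal{T}_{\lambda,\omega}(x)=x-2(x\cdot\omega)\omega+2\lambda\omega$ is the reflection with respect to the hyperplane $\{x\cdot\omega=\lambda\}$. The maximal folding function of $\mathcal{K}$ is $\mathcal{R}_{\mathcal{K}}(\omega)=\min\{\lambda\in\mathbb{R}:\ \mathcal{T}_{\lambda,\omega}(\mathcal{K}^+_{\lambda,\omega})\subseteq\mathcal{K}\}$. Let $\omega^\perp=\{x: x\cdot\omega=0\}$ and $\mathcal{P}_\omega(x)=x-(x\cdot\omega)\omega$. The shadow of $\mathcal{K}$ in the direction $\omega$ is $\mathcal{S}_\omega(\mathcal{K})=\mathcal{P}_\omega(\mathcal{K})\subset\omega^\perp$, and for $y\in\mathcal{S}_\omega(\mathcal{K})$, $a_\omega(y)=\min\{t\in\mathbb{R}: y+t\omega\in\mathcal{K}\}$ and $b_\omega(y)=\max\{t\in\mathbb{R}: y+t\omega\in\mathcal{K}\}$. *)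

theory Defs
  imports "HOL-Analysis.Analysis"
begin

definition cap :: "'a::real_inner set \<Rightarrow> real \<Rightarrow> 'a \<Rightarrow> 'a set" where
  "cap K l w = {x \<in> K. x \<bullet> w > l}"

definition reflection :: "real \<Rightarrow> 'a::real_inner \<Rightarrow> 'a \<Rightarrow> 'a" where
  "reflection l w x = x - (2 * (x \<bullet> w)) *\<^sub>R w + (2 * l) *\<^sub>R w"

(* The minima and maxima below are rendered by Least and Greatest rather than Inf and Sup:
   these are unspecified unless the extremum is attained. *)

definition max_folding :: "'a::real_inner set \<Rightarrow> 'a \<Rightarrow> real" where
  "max_folding K w = (LEAST l. reflection l w ` cap K l w \<subseteq> K)"

definition proj_perp :: "'a::real_inner \<Rightarrow> 'a \<Rightarrow> 'a" where
  "proj_perp w x = x - (x \<bullet> w) *\<^sub>R w"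

definition shadow :: "'a::real_inner \<Rightarrow> 'a set \<Rightarrow> 'a set" where
  "shadow w K = proj_perp w ` K"

definition lower_end :: "'a::real_inner set \<Rightarrow> 'a \<Rightarrow> 'a \<Rightarrow> real" where
  "lower_end K w y = (LEAST t. y + t *\<^sub>R w \<in> K)"

definition upper_end :: "'a::real_inner set \<Rightarrow> 'a \<Rightarrow> 'a \<Rightarrow> real" where
  "upper_end K w y = (GREATEST t. y + t *\<^sub>R w \<in> K)"

end

theory Submission
  imports Defs
begin

text \<open>Foliate a compact convex body \<open>K\<close> by its chords parallel to \<open>w\<close>, one for each point \<open>y\<close> of
  the shadow. The reflection in the hyperplane at height \<open>l\<close> maps each line parallel to \<open>w\<close> to
  itself, so folding can be tested chord by chord. On a chord \<open>[a, b]\<close>, the part above \<open>l\<close> folds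
  back into the chord exactly when \<open>(a + b) / 2 \<le> l\<close>. Hence the admissible \<open>l\<close> are the upper bounds
  of the chord midpoints (lemma \<open>folding_iff_chord_mid_le\<close>).

  It remains to see why the midpoint height is largest over a projected vertex, although it is the
  mean of the convex function \<open>a\<close> and the concave function \<open>b\<close> and so in general neither convex nor
  concave. The upper end of the chord over \<open>y\<close> is a convex combination of the vertices \<open>x i\<close>, with
  weights \<open>c i\<close>. This gives \<open>b y = (\<Sum>i. c i * (x i \<bullet> w)) \<le> (\<Sum>i. c i * b (y i))\<close>, where \<open>y i\<close> is
  the projection of \<open>x i\<close>: a Jensen inequality in the direction opposite to concavity, available for
  these particular weights. With the same weights, convexity gives
  \<open>a y \<le> (\<Sum>i. c i * a (y i))\<close>. So the midpoint height at \<open>y\<close> is at most a weighted mean of those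
  at the \<open>y i\<close> (lemma \<open>chord_mid_le_vertex_average\<close>).\<close>

definition chord_mid :: "'a::real_inner set \<Rightarrow> 'a \<Rightarrow> 'a \<Rightarrow> real" where
  "chord_mid K w y = (lower_end K w y + upper_end K w y) / 2"

lemma proj_perp_decomp: "proj_perp w z + (z \<bullet> w) *\<^sub>R w = z"
  by (simp add: proj_perp_def)

lemma inner_proj_perp:
  assumes "norm w = 1"
  shows "proj_perp w z \<bullet> w = 0"
  using assms by (simp add: proj_perp_def inner_diff_left dot_square_norm)

lemma proj_perp_add_scaleR:
  assumes "norm w = 1"
  shows "proj_perp w (proj_perp w z + t *\<^sub>R w) = proj_perp w z"
  using assms inner_proj_perp[OF assms, of z]
  by (simp add: proj_perp_def[of w "proj_perp w z + t *\<^sub>R w"] inner_add_left dot_square_norm)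

lemma proj_perp_sum:
  "proj_perp w (\<Sum>i\<in>I. c i *\<^sub>R x i) = (\<Sum>i\<in>I. c i *\<^sub>R proj_perp w (x i))"
  by (simp add: proj_perp_def inner_sum_left scaleR_sum_left sum_subtractf scaleR_diff_right)

text \<open>Compactness makes the least and greatest parameters of a chord attained, so that
  \<^const>\<open>lower_end\<close> and \<^const>\<open>upper_end\<close> are its actual end points.\<close>

lemma chord_eq_interval:
  fixes K :: "'a::euclidean_space set"
  assumes "compact K" "convex K" and w: "norm w = 1" and y: "y \<in> shadow w K"
  shows "{t. y + t *\<^sub>R w \<in> K} = {lower_end K w y..upper_end K w y}"
    and "lower_end K w y \<le> upper_end K w y"
proof -
  let ?C = "{t. y + t *\<^sub>R w \<in> K}"
  obtain z where z: "z \<in> K" "y = proj_perp w z"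
    using y by (auto simp: shadow_def)
  have ne: "?C \<noteq> {}"
    using z proj_perp_decomp[of w z] by (metis (mono_tags, lifting) empty_iff mem_Collect_eq)
  have C: "?C = (\<lambda>v. v \<bullet> w) ` (K \<inter> {v. proj_perp w v = y})"
  proof (intro equalityI subsetI)
    fix t assume t: "t \<in> ?C"
    show "t \<in> (\<lambda>v. v \<bullet> w) ` (K \<inter> {v. proj_perp w v = y})"
    proof (rule image_eqI)
      show "t = (y + t *\<^sub>R w) \<bullet> w"
        using w inner_proj_perp[OF w, of z] z(2) by (simp add: inner_add_left dot_square_norm)
      show "y + t *\<^sub>R w \<in> K \<inter> {v. proj_perp w v = y}"
        using t z(2) proj_perp_add_scaleR[OF w, of z] by simp
    qed
  next
    fix t assume "t \<in> (\<lambda>v. v \<bullet> w) ` (K \<inter> {v. proj_perp w v = y})"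
    then show "t \<in> ?C"
      using proj_perp_decomp[of w] by auto
  qed
  have "closed {v. proj_perp w v = y}"
    unfolding proj_perp_def by (intro closed_Collect_eq continuous_intros)
  then have cpt: "compact ?C"
    unfolding C using \<open>compact K\<close>
    by (intro compact_continuous_image continuous_intros compact_Int_closed)
  obtain a where a: "a \<in> ?C" "\<forall>t\<in>?C. a \<le> t"
    using compact_attains_inf[OF cpt ne] by blast
  obtain b where b: "b \<in> ?C" "\<forall>t\<in>?C. t \<le> b"
    using compact_attains_sup[OF cpt ne] by blast
  have ea: "lower_end K w y = a"
    unfolding lower_end_def using a by (intro Least_equality) auto
  have eb: "upper_end K w y = b"
    unfolding upper_end_def using b by (intro Greatest_equality) auto
  have "convex ?C"
  proof (rule convexI)
    fix s t u v :: real
    assume st: "s \<in> ?C" "t \<in> ?C" and uv: "0 \<le> u" "0 \<le> v" "u + v = 1"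
    have "u *\<^sub>R (y + s *\<^sub>R w) + v *\<^sub>R (y + t *\<^sub>R w) \<in> K"
      using convexD[OF \<open>convex K\<close>] st uv by blast
    also have "u *\<^sub>R (y + s *\<^sub>R w) + v *\<^sub>R (y + t *\<^sub>R w)
        = (u + v) *\<^sub>R y + (u *\<^sub>R s + v *\<^sub>R t) *\<^sub>R w"
      by (simp add: algebra_simps)
    finally show "u *\<^sub>R s + v *\<^sub>R t \<in> ?C"
      using uv by simp
  qed
  then have "{a..b} \<subseteq> ?C"
    using a b by (metis closed_segment_eq_real_ivl closed_segment_subset)
  with a b show "?C = {lower_end K w y..upper_end K w y}"
    unfolding ea eb by auto
  show "lower_end K w y \<le> upper_end K w y"
    unfolding ea eb using a b by blast
qed

text \<open>On the chord \<open>[a, b]\<close>, the reflection acts as \<open>t \<mapsto> 2 * l - t\<close>. Images of parameters above \<open>l\<close>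
  lie below \<open>l\<close>, so they can only leave the chord at its lower end, and the parameter \<open>b\<close> is
  sent lowest. A chord with \<open>b \<le> l\<close> imposes nothing, and there \<open>(a + b) / 2 \<le> l\<close> is automatic.\<close>

lemma folding_iff_chord_mid_le:
  fixes K :: "'a::euclidean_space set"
  assumes "compact K" "convex K" and w: "norm w = 1"
  shows "reflection l w ` cap K l w \<subseteq> K \<longleftrightarrow> (\<forall>y\<in>shadow w K. chord_mid K w y \<le> l)"
proof -
  have refl: "reflection l w v = proj_perp w v + (2 * l - v \<bullet> w) *\<^sub>R w" for v
    by (simp add: reflection_def proj_perp_def algebra_simps scaleR_2 flip: scaleR_scaleR)
  have chord: "y + t *\<^sub>R w \<in> K \<longleftrightarrow> lower_end K w y \<le> t \<and> t \<le> upper_end K w y"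
    if "y \<in> shadow w K" for y t
    using chord_eq_interval(1)[OF assms that] by auto
  show ?thesis
  proof (intro iffI ballI subsetI)
    fix y assume fold: "reflection l w ` cap K l w \<subseteq> K" and y: "y \<in> shadow w K"
    let ?a = "lower_end K w y" and ?b = "upper_end K w y"
    have le: "?a \<le> ?b"
      using chord_eq_interval(2)[OF assms y] .
    show "chord_mid K w y \<le> l"
    proof (cases "?b > l")
      case True
      let ?v = "y + ?b *\<^sub>R w"
      obtain z where z: "y = proj_perp w z"
        using y by (auto simp: shadow_def)
      have "?v \<in> K"
        using chord[OF y] le by simp
      moreover have h: "?v \<bullet> w = ?b"
        using w inner_proj_perp[OF w, of z] z by (simp add: inner_add_left dot_square_norm)
      ultimately have "reflection l w ?v \<in> K"
        using fold True by (auto simp: cap_def)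
      then have "y + (2 * l - ?b) *\<^sub>R w \<in> K"
        unfolding refl h using proj_perp_add_scaleR[OF w, of z] z by simp
      then have "?a \<le> 2 * l - ?b"
        using chord[OF y] by blast
      then show ?thesis
        by (simp add: chord_mid_def)
    qed (use le in \<open>simp add: chord_mid_def\<close>)
  next
    fix u assume mid: "\<forall>y\<in>shadow w K. chord_mid K w y \<le> l" and "u \<in> reflection l w ` cap K l w"
    then obtain v where v: "v \<in> K" "v \<bullet> w > l" and u: "u = reflection l w v"
      by (auto simp: cap_def)
    have y: "proj_perp w v \<in> shadow w K"
      using v by (simp add: shadow_def)
    have "lower_end K w (proj_perp w v) \<le> v \<bullet> w" "v \<bullet> w \<le> upper_end K w (proj_perp w v)"
      using chord[OF y, of "v \<bullet> w"] v by (simp_all add: proj_perp_decomp)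
    moreover have "chord_mid K w (proj_perp w v) \<le> l"
      using mid y by blast
    ultimately show "u \<in> K"
      unfolding u refl chord[OF y] using v by (simp add: chord_mid_def)
  qed
qed

text \<open>Taking the weights from the upper end of the chord, rather than from an arbitrary
  representation of \<open>y\<close>, is what bounds the concave summand \<^const>\<open>upper_end\<close> from above.\<close>

lemma chord_mid_le_vertex_average:
  fixes K :: "'a::euclidean_space set"
  assumes "compact K" "convex K" and w: "norm w = 1" and y: "y \<in> shadow w K"
    and I: "finite I" "\<And>i. i \<in> I \<Longrightarrow> x i \<in> K"
    and c: "\<And>i. i \<in> I \<Longrightarrow> 0 \<le> c i" "sum c I = 1"
    and top: "y + upper_end K w y *\<^sub>R w = (\<Sum>i\<in>I. c i *\<^sub>R x i)"
  shows "chord_mid K w y \<le> (\<Sum>i\<in>I. c i * chord_mid K w (proj_perp w (x i)))"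
proof -
  let ?p = "\<lambda>i. proj_perp w (x i)"
  have p: "?p i \<in> shadow w K" if "i \<in> I" for i
    using I(2)[OF that] by (simp add: shadow_def)
  have chord: "z + t *\<^sub>R w \<in> K \<longleftrightarrow> lower_end K w z \<le> t \<and> t \<le> upper_end K w z"
    if "z \<in> shadow w K" for z t
    using chord_eq_interval(1)[OF assms(1-3) that] by auto
  obtain z where z: "y = proj_perp w z"
    using y by (auto simp: shadow_def)
  have "upper_end K w y = (y + upper_end K w y *\<^sub>R w) \<bullet> w"
    using w inner_proj_perp[OF w, of z] z by (simp add: inner_add_left dot_square_norm)
  also have "\<dots> = (\<Sum>i\<in>I. c i * (x i \<bullet> w))"
    unfolding top by (simp add: inner_sum_left)
  also have "\<dots> \<le> (\<Sum>i\<in>I. c i * upper_end K w (?p i))"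
  proof (intro sum_mono mult_left_mono)
    fix i assume "i \<in> I"
    then show "x i \<bullet> w \<le> upper_end K w (?p i)"
      using chord[OF p, of i "x i \<bullet> w"] I(2) by (simp add: proj_perp_decomp)
  qed (use c in auto)
  finally have upper: "upper_end K w y \<le> (\<Sum>i\<in>I. c i * upper_end K w (?p i))" .
  have "proj_perp w (y + upper_end K w y *\<^sub>R w) = y"
    using proj_perp_add_scaleR[OF w, of z] z by simp
  then have py: "y = (\<Sum>i\<in>I. c i *\<^sub>R ?p i)"
    unfolding top proj_perp_sum by simp
  have "(\<Sum>i\<in>I. c i *\<^sub>R (?p i + lower_end K w (?p i) *\<^sub>R w)) \<in> K"
  proof (rule convex_sum[OF I(1) \<open>convex K\<close> c(2) c(1)])
    fix i assume "i \<in> I"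
    then show "?p i + lower_end K w (?p i) *\<^sub>R w \<in> K"
      using chord[OF p] chord_eq_interval(2)[OF assms(1-3) p] by simp
  qed
  also have "(\<Sum>i\<in>I. c i *\<^sub>R (?p i + lower_end K w (?p i) *\<^sub>R w))
      = y + (\<Sum>i\<in>I. c i * lower_end K w (?p i)) *\<^sub>R w"
    by (simp add: scaleR_add_right sum.distrib scaleR_sum_left flip: py)
  finally have lower: "lower_end K w y \<le> (\<Sum>i\<in>I. c i * lower_end K w (?p i))"
    using chord[OF y] by blast
  have "(\<Sum>i\<in>I. c i * chord_mid K w (?p i))
      = ((\<Sum>i\<in>I. c i * lower_end K w (?p i)) + (\<Sum>i\<in>I. c i * upper_end K w (?p i))) / 2"
    by (simp add: chord_mid_def sum.distrib distrib_left sum_divide_distrib add_divide_distrib)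
  with lower upper show ?thesis
    by (simp add: chord_mid_def)
qed

theorem theorem5p3:
  fixes K :: "(real ^ 'n) set"
    and x :: "nat \<Rightarrow> real ^ 'n"
    and s :: nat
    and w :: "real ^ 'n"
    and f :: "real ^ 'n \<Rightarrow> real"
  assumes "CARD('n) \<ge> 2"
    and "K = {z. \<exists>c. (\<forall>i\<in>{1..s}. c i \<in> {0..1::real}) \<and> (\<Sum>i=1..s. c i) = 1 \<and>
                     z = (\<Sum>i=1..s. c i *\<^sub>R x i)}"
    and "bij_betw x {1..s} {v. v extreme_point_of K}"
    and "aff_dim K = int CARD('n)"
    and "w \<in> sphere 0 1"
    and "\<And>y. y \<in> shadow w K \<Longrightarrow> f y = (lower_end K w y + upper_end K w y) / 2"
  shows "max_folding K w = Max {f (proj_perp w (x j)) | j. j \<in> {1..s}}"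
proof -
  have w: "norm w = 1"
    using assms(5) by simp
  have vert: "x i \<in> K" if "i \<in> {1..s}" for i
    using assms(3) that by (auto simp: bij_betw_def extreme_point_of_def)
  have hull: "K = convex hull (x ` {1..s})"
  proof
    show "K \<subseteq> convex hull (x ` {1..s})"
    proof
      fix z assume "z \<in> K"
      then obtain c where c: "\<forall>i\<in>{1..s}. c i \<in> {0..1::real}" "sum c {1..s} = 1"
        and z: "z = (\<Sum>i=1..s. c i *\<^sub>R x i)"
        unfolding assms(2) by blast
      show "z \<in> convex hull (x ` {1..s})"
        unfolding z using c by (intro convex_sum convex_convex_hull hull_inc) auto
    qed
    show "convex hull (x ` {1..s}) \<subseteq> K"
    proof
      fix z assume "z \<in> convex hull (x ` {1..s})"
      then obtain u where u: "\<forall>v\<in>x ` {1..s}. 0 \<le> u v" "sum u (x ` {1..s}) = 1"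
        "(\<Sum>v\<in>x ` {1..s}. u v *\<^sub>R v) = z"
        by (auto simp: convex_hull_finite)
      have inj: "inj_on x {1..s}"
        using assms(3) by (simp add: bij_betw_def)
      have one: "(\<Sum>i=1..s. u (x i)) = 1" and eq: "z = (\<Sum>i=1..s. u (x i) *\<^sub>R x i)"
        using u sum.reindex[OF inj, of u] sum.reindex[OF inj, of "\<lambda>v. u v *\<^sub>R v"]
        by (simp_all add: o_def)
      have "u (x i) \<le> 1" if "i \<in> {1..s}" for i
        using member_le_sum[of i "{1..s}" "\<lambda>i. u (x i)"] that u(1) one by auto
      with u(1) one eq show "z \<in> K"
        unfolding assms(2) by (intro CollectI exI[of _ "\<lambda>i. u (x i)"]) auto
    qed
  qed
  have K: "compact K" "convex K"
    unfolding hull by (auto intro: finite_imp_compact_convex_hull)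
  have "K \<noteq> {}"
    using assms(4) by auto
  then have "{1..s} \<noteq> {}"
    unfolding hull by auto
  define M where "M = Max ((\<lambda>j. f (proj_perp w (x j))) ` {1..s})"
  have sh: "proj_perp w (x j) \<in> shadow w K" if "j \<in> {1..s}" for j
    using vert[OF that] by (simp add: shadow_def)
  have f: "f y = chord_mid K w y" if "y \<in> shadow w K" for y
    using assms(6)[OF that] by (simp add: chord_mid_def)
  have M_ge: "f (proj_perp w (x j)) \<le> M" if "j \<in> {1..s}" for j
    using that by (auto simp: M_def)
  have "M \<in> (\<lambda>j. f (proj_perp w (x j))) ` {1..s}"
    unfolding M_def using \<open>{1..s} \<noteq> {}\<close> by (intro Max_in) auto
  then obtain m where m: "m \<in> {1..s}" "M = f (proj_perp w (x m))"
    by blast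
  have bound: "chord_mid K w y \<le> M" if y: "y \<in> shadow w K" for y
  proof -
    have "y + upper_end K w y *\<^sub>R w \<in> K"
      using chord_eq_interval[OF K w y] by auto
    then obtain c where c: "\<forall>i\<in>{1..s}. c i \<in> {0..1::real}" "sum c {1..s} = 1"
      "y + upper_end K w y *\<^sub>R w = (\<Sum>i=1..s. c i *\<^sub>R x i)"
      unfolding assms(2) by blast
    have "chord_mid K w y \<le> (\<Sum>i=1..s. c i * chord_mid K w (proj_perp w (x i)))"
      using c by (intro chord_mid_le_vertex_average K w y vert) auto
    also have "\<dots> \<le> (\<Sum>i=1..s. c i * M)"
      using c(1) M_ge f[OF sh] by (intro sum_mono mult_left_mono) auto
    also have "\<dots> = M"
      using c(2) by (simp flip: sum_distrib_right)
    finally show ?thesis .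
  qed
  have "max_folding K w = M"
    unfolding max_folding_def folding_iff_chord_mid_le[OF K w]
  proof (rule Least_equality)
    show "\<forall>y\<in>shadow w K. chord_mid K w y \<le> M"
      using bound by blast
    show "M \<le> l" if "\<forall>y\<in>shadow w K. chord_mid K w y \<le> l" for l
      using that sh[OF m(1)] f m(2) by auto
  qed
  then show ?thesis
    unfolding M_def by (simp only: setcompr_eq_image Collect_mem_eq)
qed

end
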